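(* Let $(\bar x,\bar y)\in X\times Y(\bar x)$. (a) Suppose that either $Y(\bar x)=\mathbb{R}^m$ or $f(\bar x,\cdot)$ is semidifferentiable at $\bar y$. Suppose further that $f(x,\cdot)$ is continuous for any $x\in X$ near $\bar x$. If $(\bar x,\bar y)$ is a calm local minimax point of the problem $\min_{x\in X}\max_{y\in Y(x)}f(x,y)$, then $$\sup_{h\in DY(\bar x,\bar y)(u)}{\rm d}^+f(\bar x,\bar y)(u,h)\ge 0\quad\forall\,u\in T_X(\bar x),\qquad {\rm d}_y^+f(\bar x,\bar y)(h)\le 0\quad\forall\,h\in T_{Y(\bar x)}(\bar y).$$ (b) Suppose that $f$ is semidifferentiable at $(\bar x,\bar y)$, that the set-valued mapping $Y$ is semidifferentiable at $\bar x$ for $\bar y$ and calm around $(\bar x,\bar y)$, and that $$\sup_{h\in DY(\bar x,\bar y)(u)}{\rm d}f(\bar x,\bar y)(u,h)>0\quad\forall\,u\in T_X(\bar x)\setminus\{0\},\qquad {\rm d}_yf(\bar x,\bar y)(h)<0\quad\forall\,h\in T_{Y(\bar x)}(\bar y)\setminus\{0\}.$$ Then $(\bar x,\bar y)$ is a calm local minimax point of the problem $\min_{x\in X}\max_{y\in Y(x)}f(x,y)$.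
   Context: Setting: $f:\mathbb{R}^n\times\mathbb{R}^m\to\mathbb{R}$ (possibly nonsmooth), $X\subseteq\mathbb{R}^n$ nonempty closed, $Y:\mathbb{R}^n\rightrightarrows\mathbb{R}^m$ a set-valued map with $Y(x)$ nonempty and closed for each $x\in X$; for each $x\in X$ the solution set of $\max_{y'\in Y(x)}f(x,y')$ is nonempty. $\mathbb{B}_r(z)$ is the closed Euclidean ball of radius $r$ centred at $z$; $\mathbb{B}$ is the closed unit ball. Calm local minimax point: $(\bar x,\bar y)\in X\times Y(\bar x)$ is a calm local minimax point if there exist $\delta_0>0$ and $\tau:\mathbb{R}_+\to\mathbb{R}_+$ with $\tau(\delta)\to0$ as $\delta\downarrow0$ and $\tau(\delta)\le\kappa\delta$ for some $\kappa>0$, such that for any $\delta\in(0,\delta_0]$, any $x\in X\cap\mathbb{B}_\delta(\bar x)$ and $y\in Y(\bar x)\cap\mathbb{B}_\delta(\bar y)$, $$f(\bar x,y)\le f(\bar x,\bar y)\le\max_{y'\in Y(x)\cap\mathbb{B}_{\tau(\delta)}(\bar y)}f(x,y').$$ Standing assumption: for the radius function $\tau$ considered there is $\delta_0>0$ with $Y(x)\cap\mathbb{B}_{\tau(\delta)}(\bar y)\ne\emptyset$ for all $\delta\in(0,\delta_0]$ and $x\in X\cap\mathbb{B}_\delta(\bar x)$. Tangent cone: $T_S(\bar z)=\{w\mid\exists t_k\downarrow0,\ w_k\to w,\ \bar z+t_kw_k\in S\}$. Graphical derivative: $h\in DY(\bar x,\bar y)(u)\iff(u,h)\in T_{\operatorname{gph}Y}(\bar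 x,\bar y)$, where $\operatorname{gph}Y=\{(x,y)\mid y\in Y(x)\}$; equivalently $DY(\bar x,\bar y)(u)=\limsup_{t\downarrow0,u'\to u}\frac{Y(\bar x+tu')-\bar y}{t}$ (Painlevé–Kuratowski). $Y$ is semidifferentiable at $\bar x$ for $\bar y$ if for every $u\in\mathbb{R}^n$ the Painlevé–Kuratowski limit $\lim_{t\downarrow0,u'\to u}\frac{Y(\bar x+tu')-\bar y}{t}$ exists (outer limit equals inner limit). $Y$ is calm around $(\bar x,\bar y)$ if there are $l>0$ and neighborhoods $U$ of $\bar x$, $V$ of $\bar y$ with $Y(x)\cap V\subseteq\bar y+l\|x-\bar x\|\mathbb{B}$ for all $x\in U$. For a function $\psi$ finite at $\bar z$: subderivative ${\rm d}\psi(\bar z)(w)=\liminf_{t\downarrow0,w'\to w}\frac{\psi(\bar z+tw')-\psi(\bar z)}{t}$; superderivative ${\rm d}^+\psi(\bar z)(w)=\limsup_{t\downarrow0,w'\to w}\frac{\psi(\bar z+tw')-\psi(\bar z)}{t}$. $\psi$ is semidifferentiable at $\bar z$ if these agree, i.e. the full limit exists, for every $w$. ${\rm d}_yf(\bar x,\bar y)(h)$ and ${\rm d}_y^+f(\bar x,\bar y)(h)$ denote the subderivative and superderivative of $f(\bar x,\cdot)$ at $\bar y$ for $h$.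
   Formalization: In the definition of a calm local minimax point, the inner max over Y(x)∩B_τ(δ)(ȳ) is read as a supremum, since under the hypotheses of (b) this local maximum need not be attained; the two agree whenever the maximum exists. *)

theory Defs
  imports "HOL-Analysis.Analysis"
begin

definition tangent_cone :: "'z::real_normed_vector set \<Rightarrow> 'z \<Rightarrow> 'z set" where
  "tangent_cone S z = {w. \<exists>t v. (\<forall>k. t k > 0) \<and> t \<longlonglongrightarrow> (0::real) \<and> v \<longlonglongrightarrow> w \<and>
     (\<forall>k::nat. z + t k *\<^sub>R v k \<in> S)}"

definition gph :: "('a \<Rightarrow> 'b set) \<Rightarrow> ('a \<times> 'b) set" where
  "gph Y = {(x, y). y \<in> Y x}"

definition graphical_derivative ::
  "('a::real_normed_vector \<Rightarrow> 'b::real_normed_vector set) \<Rightarrow> 'a \<Rightarrow> 'b \<Rightarrow> 'a \<Rightarrow> 'b set" where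
  "graphical_derivative Y x y u = {h. (u, h) \<in> tangent_cone (gph Y) (x, y)}"

text \<open>Painleve--Kuratowski outer and inner limits of a set-valued map along a filter, in the
  sequential form of Rockafellar and Wets.\<close>

definition outer_limit :: "'p filter \<Rightarrow> ('p \<Rightarrow> 'b::topological_space set) \<Rightarrow> 'b set" where
  "outer_limit F S = {h. \<exists>p v. filterlim p F sequentially \<and> v \<longlonglongrightarrow> h \<and>
     (\<forall>\<^sub>F k in sequentially. v k \<in> S (p k))}"

definition inner_limit :: "'p filter \<Rightarrow> ('p \<Rightarrow> 'b::topological_space set) \<Rightarrow> 'b set" where
  "inner_limit F S = {h. \<forall>p. filterlim p F sequentially \<longrightarrow>
     (\<exists>v. v \<longlonglongrightarrow> h \<and> (\<forall>\<^sub>F k in sequentially. v k \<in> S (p k)))}"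

text \<open>The filter describing \<open>t \<down> 0, w' \<rightarrow> w\<close>; the value \<open>w' = w\<close> is allowed.\<close>

definition dir_filter :: "'z::topological_space \<Rightarrow> (real \<times> 'z) filter" where
  "dir_filter w = at_right 0 \<times>\<^sub>F nhds w"

definition semidifferentiable_map ::
  "('a::real_normed_vector \<Rightarrow> 'b::real_normed_vector set) \<Rightarrow> 'a \<Rightarrow> 'b \<Rightarrow> bool" where
  "semidifferentiable_map Y x y \<longleftrightarrow>
     (\<forall>u. let Q = (\<lambda>(t, u'). (\<lambda>y'. (y' - y) /\<^sub>R t) ` Y (x + t *\<^sub>R u'))
          in outer_limit (dir_filter u) Q = inner_limit (dir_filter u) Q)"

definition calm_map_around ::
  "('a::real_normed_vector \<Rightarrow> 'b::real_normed_vector set) \<Rightarrow> 'a \<Rightarrow> 'b \<Rightarrow> bool" where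
  "calm_map_around Y x y \<longleftrightarrow>
     (\<exists>l>0. \<exists>U V. open U \<and> x \<in> U \<and> open V \<and> y \<in> V \<and>
        (\<forall>x'\<in>U. Y x' \<inter> V \<subseteq> cball y (l * norm (x' - x))))"

definition subderivative :: "('z::real_normed_vector \<Rightarrow> real) \<Rightarrow> 'z \<Rightarrow> 'z \<Rightarrow> ereal" where
  "subderivative \<psi> z w =
     Liminf (dir_filter w) (\<lambda>(t, w'). ereal ((\<psi> (z + t *\<^sub>R w') - \<psi> z) / t))"

definition superderivative :: "('z::real_normed_vector \<Rightarrow> real) \<Rightarrow> 'z \<Rightarrow> 'z \<Rightarrow> ereal" where
  "superderivative \<psi> z w =
     Limsup (dir_filter w) (\<lambda>(t, w'). ereal ((\<psi> (z + t *\<^sub>R w') - \<psi> z) / t))"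

text \<open>Finiteness of the semiderivatives need not be required: for \<open>w = 0\<close> the common value
  is necessarily \<open>0\<close>, which bounds the difference quotients in every direction.\<close>

definition semidifferentiable_fun :: "('z::real_normed_vector \<Rightarrow> real) \<Rightarrow> 'z \<Rightarrow> bool" where
  "semidifferentiable_fun \<psi> z \<longleftrightarrow> (\<forall>w. subderivative \<psi> z w = superderivative \<psi> z w)"

text \<open>The inner maximum is written as a supremum in the extended reals. The supremum over the
  empty set is \<open>-\<infinity>\<close>, so the inequality entails that \<open>Y x \<inter> cball ybar (\<tau> \<delta>)\<close> is nonempty; if
  \<open>f (x, \<cdot>)\<close> is upper semicontinuous and \<open>Y x\<close> is closed, the supremum is then attained.\<close>

definition calm_local_minimax ::
  "('a::real_normed_vector \<times> 'b::real_normed_vector \<Rightarrow> real) \<Rightarrow> 'a set \<Rightarrow> ('a \<Rightarrow> 'b set) \<Rightarrow>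
   'a \<Rightarrow> 'b \<Rightarrow> bool" where
  "calm_local_minimax f X Y xbar ybar \<longleftrightarrow>
     xbar \<in> X \<and> ybar \<in> Y xbar \<and>
     (\<exists>\<delta>\<^sub>0>0. \<exists>\<tau>::real \<Rightarrow> real.
        (\<forall>\<delta>\<ge>0. \<tau> \<delta> \<ge> 0) \<and> (\<tau> \<longlongrightarrow> 0) (at_right 0) \<and>
        (\<exists>\<kappa>>0. \<forall>\<delta>\<ge>0. \<tau> \<delta> \<le> \<kappa> * \<delta>) \<and>
        (\<forall>\<delta>\<in>{0<..\<delta>\<^sub>0}. \<forall>x\<in>X \<inter> cball xbar \<delta>. \<forall>y\<in>Y xbar \<inter> cball ybar \<delta>.
           f (xbar, y) \<le> f (xbar, ybar) \<and>
           ereal (f (xbar, ybar)) \<le> (SUP y'\<in>Y x \<inter> cball ybar (\<tau> \<delta>). ereal (f (x, y')))))"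

end

theory Submission
  imports Defs
begin

text \<open>
  Everything rests on difference quotients along sequences \<open>t\<^sub>k \<down> 0\<close>, \<open>w\<^sub>k \<rightarrow> w\<close>: a bound on the
  superderivative (or subderivative) at \<open>w\<close> is inherited, up to an arbitrarily small slope, by
  the function at the points \<open>z + t\<^sub>k w\<^sub>k\<close>.

  Necessity. A tangent direction \<open>u\<close> of \<open>X\<close> comes with points \<open>x\<^sub>k = xbar + t\<^sub>k u\<^sub>k\<close> of \<open>X\<close>.
  Apply the minimax inequality at radius \<open>\<delta>\<^sub>k\<close> proportional to \<open>t\<^sub>k\<close> and choose \<open>y\<^sub>k \<in> Y x\<^sub>k\<close>
  with \<open>f (x\<^sub>k, y\<^sub>k) > f (xbar, ybar) - t\<^sub>k\<^sup>2\<close>. Linear growth of the radius function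
  keeps \<open>(y\<^sub>k - ybar) / t\<^sub>k\<close> bounded, so a subsequence converges to some \<open>h\<close> in the graphical
  derivative at \<open>u\<close>, and the error \<open>t\<^sub>k\<^sup>2\<close> is invisible to first order: the superderivative at
  \<open>(u, h)\<close> is nonnegative. The minimax inequality in \<open>y\<close> says that \<open>ybar\<close> maximises
  \<open>f (xbar, \<cdot>)\<close> over \<open>Y xbar\<close> locally. Along feasible sequences this controls the
  subderivative; it controls the superderivative when all nearby points are feasible, or when the
  two derivatives agree.

  Sufficiency. With \<open>l\<close> the calmness constant of \<open>Y\<close>, the radius function \<open>\<tau> \<delta> = l \<delta>\<close> works.
  Calmness at \<open>xbar\<close> itself makes \<open>ybar\<close> isolated in \<open>Y xbar\<close>, which settles the
  inequality in \<open>y\<close>. If the inequality in \<open>x\<close> failed at points \<open>x\<^sub>k \<rightarrow> xbar\<close> of \<open>X\<close>, the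
  normalised differences would cluster at a unit tangent direction \<open>u\<close>; pick \<open>h\<close> with positive
  subderivative at \<open>(u, h)\<close>. Semidifferentiability of \<open>Y\<close> says that \<open>h\<close> is reached along
  \<^emph>\<open>every\<close> sequence of directions, in particular by \<open>y\<^sub>k \<in> Y x\<^sub>k\<close> over the given points.
  Calmness puts \<open>y\<^sub>k\<close> into the required ball, and
  the subderivative forces \<open>f (x\<^sub>k, y\<^sub>k) > f (xbar, ybar)\<close>, a contradiction.
\<close>

section \<open>Difference quotients along sequences\<close>

lemma filterlim_dir_filter:
  assumes "\<And>k. t k > 0" and "t \<longlonglongrightarrow> 0" and "v \<longlonglongrightarrow> w"
  shows "filterlim (\<lambda>k. (t k, v k)) (dir_filter w) sequentially"
  unfolding dir_filter_def
  using assms by (intro filterlim_Pair tendsto_imp_filterlim_at_right) auto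

lemma eventually_dir_filter_pos: "\<forall>\<^sub>F (t, w') in dir_filter w. t > 0"
  unfolding dir_filter_def
  using eventually_prodI[OF eventually_at_right_less[of "0::real"] eventually_True[of "nhds w"]]
  by (simp add: case_prod_unfold)

text \<open>Dropping finitely many terms turns an eventual property into one of the whole sequence.\<close>

lemma tangent_coneE:
  assumes w: "w \<in> tangent_cone S z" and P: "eventually P (dir_filter w)"
  obtains t v where "\<And>k. t k > 0" and "t \<longlonglongrightarrow> 0" and "v \<longlonglongrightarrow> w"
    and "\<And>k. z + t k *\<^sub>R v k \<in> S" and "\<And>k. P (t k, v k)"
proof -
  obtain t v where tv: "\<And>k. t k > 0" "t \<longlonglongrightarrow> 0" "v \<longlonglongrightarrow> w" "\<And>k::nat. z + t k *\<^sub>R v k \<in> S"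
    using w unfolding tangent_cone_def by blast
  have "\<forall>\<^sub>F k in sequentially. P (t k, v k)"
    by (rule eventually_compose_filterlim[OF P filterlim_dir_filter[OF tv(1-3)]])
  then obtain N where N: "\<And>k. k \<ge> N \<Longrightarrow> P (t k, v k)"
    unfolding eventually_sequentially by blast
  show thesis
    by (rule that[of "\<lambda>k. t (k + N)" "\<lambda>k. v (k + N)"])
      (use tv N in \<open>auto intro: LIMSEQ_ignore_initial_segment\<close>)
qed

lemma eventually_less_if_superderivative_less:
  assumes "superderivative \<psi> z w < ereal c"
  shows "\<forall>\<^sub>F (t, w') in dir_filter w. \<psi> (z + t *\<^sub>R w') < \<psi> z + c * t"
proof -
  have "\<forall>\<^sub>F (t, w') in dir_filter w. ereal ((\<psi> (z + t *\<^sub>R w') - \<psi> z) / t) < ereal c"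
    using Limsup_lessD[OF assms[unfolded superderivative_def]] by (simp add: case_prod_unfold)
  then show ?thesis
    using eventually_dir_filter_pos[of w]
    by eventually_elim (auto simp: divide_less_eq split: if_splits)
qed

lemma eventually_greater_if_subderivative_greater:
  assumes "subderivative \<psi> z w > ereal c"
  shows "\<forall>\<^sub>F (t, w') in dir_filter w. \<psi> (z + t *\<^sub>R w') > \<psi> z + c * t"
proof -
  have "\<forall>\<^sub>F (t, w') in dir_filter w. ereal ((\<psi> (z + t *\<^sub>R w') - \<psi> z) / t) > ereal c"
    using less_LiminfD[OF assms[unfolded subderivative_def]] by (simp add: case_prod_unfold)
  then show ?thesis
    using eventually_dir_filter_pos[of w]
    by eventually_elim (auto simp: less_divide_eq split: if_splits)
qed

section \<open>Necessary conditions\<close>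

text \<open>The slack \<open>(t k)\<^sup>2\<close> is of second order, so a superderivative below some \<open>c < 0\<close> would
  make \<open>\<psi>\<close> drop by more than the slack.\<close>

lemma superderivative_nonneg_if_second_order_decrease:
  assumes t: "\<And>k. t k > 0" "t \<longlonglongrightarrow> 0" and v: "v \<longlonglongrightarrow> w"
    and ge: "\<And>k. \<psi> (z + t k *\<^sub>R v k) \<ge> \<psi> z - (t k)\<^sup>2"
  shows "superderivative \<psi> z w \<ge> 0"
proof (rule ccontr)
  assume "\<not> ?thesis"
  then obtain c where c: "superderivative \<psi> z w < ereal c" "c < 0"
    using ereal_dense2[of "superderivative \<psi> z w" 0] by (auto simp: not_le)
  have "\<forall>\<^sub>F k in sequentially. \<psi> (z + t k *\<^sub>R v k) < \<psi> z + c * t k"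
    using eventually_compose_filterlim[OF eventually_less_if_superderivative_less[OF c(1)]
        filterlim_dir_filter[OF t v]] by simp
  moreover have "\<forall>\<^sub>F k in sequentially. t k < - c"
    using order_tendstoD(2)[OF t(2), of "- c"] c by simp
  ultimately have "\<forall>\<^sub>F k in sequentially. False"
  proof eventually_elim
    case (elim k)
    have "t k * t k < - c * t k"
      using elim(2) t(1)[of k] by (intro mult_strict_right_mono) auto
    then show ?case
      using elim(1) ge[of k] by (simp add: power2_eq_square)
  qed
  then show False by simp
qed

text \<open>The direction \<open>h\<close> is a cluster point of the quotients \<open>(y\<^sub>k - ybar) / t\<^sub>k\<close> of almost
  maximisers \<open>y\<^sub>k\<close>; the linear bound on the radius function provides the compactness.\<close>

lemma calm_local_minimax_imp_superderivative_nonneg: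
  fixes f :: "'a::euclidean_space \<times> 'b::euclidean_space \<Rightarrow> real"
  assumes minimax: "calm_local_minimax f X Y xbar ybar" and u: "u \<in> tangent_cone X xbar"
  obtains h where "h \<in> graphical_derivative Y xbar ybar u"
    and "superderivative f (xbar, ybar) (u, h) \<ge> 0"
proof -
  obtain \<delta>\<^sub>0 \<tau> \<kappa> where ybar: "ybar \<in> Y xbar" and "\<delta>\<^sub>0 > 0" and "\<kappa> > 0"
    and \<tau>: "\<And>\<delta>. \<delta> \<ge> 0 \<Longrightarrow> \<tau> \<delta> \<le> \<kappa> * \<delta>"
    and mm: "\<forall>\<delta>\<in>{0<..\<delta>\<^sub>0}. \<forall>x\<in>X \<inter> cball xbar \<delta>. \<forall>y\<in>Y xbar \<inter> cball ybar \<delta>.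
      f (xbar, y) \<le> f (xbar, ybar) \<and>
      ereal (f (xbar, ybar)) \<le> (SUP y'\<in>Y x \<inter> cball ybar (\<tau> \<delta>). ereal (f (x, y')))"
    using minimax unfolding calm_local_minimax_def by metis
  define M where "M = norm u + 1"
  have "M > 0" by (simp add: M_def add_nonneg_pos)
  \<comment> \<open>Since \<open>u\<^sub>k \<rightarrow> u\<close>, the radius \<open>M * t\<close> eventually covers \<open>xbar + t u\<^sub>k\<close>.\<close>
  have small: "\<forall>\<^sub>F t in at_right 0. M * t \<le> \<delta>\<^sub>0"
  proof -
    have "((\<lambda>t. M * t) \<longlongrightarrow> M * 0) (at_right 0)" by (intro tendsto_intros)
    then have "\<forall>\<^sub>F t in at_right 0. M * t < \<delta>\<^sub>0"
      using \<open>\<delta>\<^sub>0 > 0\<close> by (intro order_tendstoD(2)) auto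
    then show ?thesis by eventually_elim simp
  qed
  have near: "\<forall>\<^sub>F u' in nhds u. norm u' \<le> M"
  proof -
    have "((\<lambda>u'. norm u') \<longlongrightarrow> norm u) (nhds u)"
      by (rule tendsto_norm[OF filterlim_ident])
    then have "\<forall>\<^sub>F u' in nhds u. norm u' < M"
      by (rule order_tendstoD(2)) (simp add: M_def)
    then show ?thesis by eventually_elim simp
  qed
  have "\<forall>\<^sub>F p in dir_filter u. M * fst p \<le> \<delta>\<^sub>0 \<and> norm (snd p) \<le> M"
    unfolding dir_filter_def by (rule eventually_prodI[OF small near])
  then obtain t v where t: "\<And>k. t k > 0" "t \<longlonglongrightarrow> 0" and v: "v \<longlonglongrightarrow> u"
    and vX: "\<And>k. xbar + t k *\<^sub>R v k \<in> X" 
    and "\<And>k. M * fst (t k, v k) \<le> \<delta>\<^sub>0 \<and> norm (snd (t k, v k)) \<le> M"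
    by (rule tangent_coneE[OF u]) blast
  then have bd: "M * t k \<le> \<delta>\<^sub>0" "norm (v k) \<le> M" for k
    by simp_all
  have "\<exists>y. y \<in> Y (xbar + t k *\<^sub>R v k) \<and> norm (y - ybar) \<le> \<kappa> * (M * t k) \<and>
      f (xbar + t k *\<^sub>R v k, y) \<ge> f (xbar, ybar) - (t k)\<^sup>2" for k
  proof -
    let ?x = "xbar + t k *\<^sub>R v k"
    have Mt: "M * t k > 0" using \<open>M > 0\<close> t by simp
    have xk: "?x \<in> cball xbar (M * t k)"
      using mult_left_mono[OF bd(2)[of k], of "t k"] t(1)[of k]
      by (simp add: dist_norm mult.commute)
    have "ereal (f (xbar, ybar) - (t k)\<^sup>2) < ereal (f (xbar, ybar))"
      using t(1)[of k] by simp
    also have "\<dots> \<le> (SUP y'\<in>Y ?x \<inter> cball ybar (\<tau> (M * t k)). ereal (f (?x, y')))"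
    proof (rule mm[rule_format, THEN conjunct2])
      show "M * t k \<in> {0<..\<delta>\<^sub>0}" using Mt bd(1) by simp
      show "?x \<in> X \<inter> cball xbar (M * t k)" using vX xk by blast
      show "ybar \<in> Y xbar \<inter> cball ybar (M * t k)" using ybar Mt by simp
    qed
    finally obtain y where yY: "y \<in> Y ?x" and "y \<in> cball ybar (\<tau> (M * t k))"
      and "ereal (f (xbar, ybar) - (t k)\<^sup>2) < ereal (f (?x, y))"
      unfolding less_SUP_iff by blast
    then have "norm (y - ybar) \<le> \<tau> (M * t k)" and "f (xbar, ybar) - (t k)\<^sup>2 \<le> f (?x, y)"
      by (simp_all add: dist_norm norm_minus_commute)
    moreover have "\<tau> (M * t k) \<le> \<kappa> * (M * t k)"
      using Mt by (intro \<tau>) simp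
    ultimately show ?thesis
      using yY by (intro exI[of _ y]) simp
  qed
  then obtain y where y: "\<And>k. y k \<in> Y (xbar + t k *\<^sub>R v k)"
    and yb: "\<And>k. norm (y k - ybar) \<le> \<kappa> * (M * t k)"
    and fy: "\<And>k. f (xbar + t k *\<^sub>R v k, y k) \<ge> f (xbar, ybar) - (t k)\<^sup>2"
    by metis
  define q where "q k = (y k - ybar) /\<^sub>R t k" for k
  have yq: "ybar + t k *\<^sub>R q k = y k" for k
    using t(1)[of k] by (simp add: q_def)
  have "norm (q k) \<le> \<kappa> * M" for k
  proof -
    have "norm (q k) = norm (y k - ybar) / t k"
      using t(1)[of k] by (simp add: q_def divide_inverse mult.commute)
    also have "\<dots> \<le> \<kappa> * M"
      using yb[of k] t(1)[of k] by (simp add: pos_divide_le_eq mult.assoc)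
    finally show ?thesis .
  qed
  then have "bounded (range q)" unfolding bounded_iff by auto
  then obtain h r where r: "strict_mono r" and h: "(q \<circ> r) \<longlonglongrightarrow> h"
    using bounded_imp_convergent_subsequence[of q] by blast
  define s where "s = (\<lambda>k. t (r k))"
  define w where "w = (\<lambda>k. (v (r k), q (r k)))"
  have s: "\<And>k. s k > 0" "s \<longlonglongrightarrow> 0"
    using t LIMSEQ_subseq_LIMSEQ[OF t(2) r] by (auto simp: s_def o_def)
  have w: "w \<longlonglongrightarrow> (u, h)"
    unfolding w_def using LIMSEQ_subseq_LIMSEQ[OF v r] h
    by (intro tendsto_Pair) (auto simp: o_def)
  have pt: "(xbar, ybar) + s k *\<^sub>R w k = (xbar + t (r k) *\<^sub>R v (r k), y (r k))" for k
    by (simp add: s_def w_def yq)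
  show thesis
  proof (rule that)
    show "h \<in> graphical_derivative Y xbar ybar u"
      unfolding graphical_derivative_def tangent_cone_def
    proof (intro CollectI exI conjI allI)
      show "(xbar, ybar) + s k *\<^sub>R w k \<in> gph Y" for k
        unfolding pt gph_def using y by simp
    qed (use s w in auto)
    show "superderivative f (xbar, ybar) (u, h) \<ge> 0"
    proof (rule superderivative_nonneg_if_second_order_decrease[OF s w])
      show "f ((xbar, ybar) + s k *\<^sub>R w k) \<ge> f (xbar, ybar) - (s k)\<^sup>2" for k
        unfolding pt unfolding s_def by (rule fy)
    qed
  qed
qed

text \<open>At a local maximiser the subderivative is nonpositive in every tangent direction, because a
  single feasible sequence suffices to bound a lower limit. The superderivative
  takes all nearby directions into account, hence the two alternatives.\<close>

lemma superderivative_nonpos_if_local_max: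
  assumes max: "\<forall>\<^sub>F y in nhds z. y \<in> S \<longrightarrow> \<psi> y \<le> \<psi> z"
    and alt: "S = UNIV \<or> semidifferentiable_fun \<psi> z"
    and h: "h \<in> tangent_cone S z"
  shows "superderivative \<psi> z h \<le> 0"
proof -
  have "filterlim (\<lambda>p. z + fst p *\<^sub>R snd p) (nhds z) (dir_filter h)"
  proof -
    have "((\<lambda>p. z + fst p *\<^sub>R snd p) \<longlongrightarrow> z + 0 *\<^sub>R h) (dir_filter h)"
      unfolding dir_filter_def
      by (intro tendsto_intros filterlim_compose[OF _ filterlim_fst]
          filterlim_compose[OF _ filterlim_snd])
        (auto intro: filterlim_ident tendsto_ident_at)
    then show ?thesis by simp
  qed
  then have ev: "\<forall>\<^sub>F p in dir_filter h. z + fst p *\<^sub>R snd p \<in> S \<longrightarrow>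
      \<psi> (z + fst p *\<^sub>R snd p) \<le> \<psi> z"
    by (rule eventually_compose_filterlim[OF max])
  from alt show ?thesis
  proof
    assume "S = UNIV"
    from ev eventually_dir_filter_pos[of h]
    have "\<forall>\<^sub>F (t, w') in dir_filter h. ereal ((\<psi> (z + t *\<^sub>R w') - \<psi> z) / t) \<le> 0"
      by eventually_elim (use \<open>S = UNIV\<close> in \<open>auto simp: divide_le_0_iff zero_ereal_def\<close>)
    then show ?thesis
      unfolding superderivative_def by (intro Limsup_bounded) (simp add: case_prod_unfold)
  next
    assume "semidifferentiable_fun \<psi> z"
    moreover have "subderivative \<psi> z h \<le> 0"
    proof (rule ccontr)
      assume "\<not> ?thesis"
      then have "subderivative \<psi> z h > ereal 0" by (simp add: zero_ereal_def)
      then have "\<forall>\<^sub>F (t, w') in dir_filter h. \<psi> (z + t *\<^sub>R w') > \<psi> z"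
        using eventually_greater_if_subderivative_greater by fastforce
      then have "\<forall>\<^sub>F p in dir_filter h. z + fst p *\<^sub>R snd p \<notin> S"
        using ev by eventually_elim (auto simp: case_prod_unfold)
      then show False
        by (rule tangent_coneE[OF h]) auto
    qed
    ultimately show ?thesis
      unfolding semidifferentiable_fun_def by simp
  qed
qed

lemma calm_local_minimax_imp_local_max:
  assumes "calm_local_minimax f X Y xbar ybar"
  shows "\<forall>\<^sub>F y in nhds ybar. y \<in> Y xbar \<longrightarrow> f (xbar, y) \<le> f (xbar, ybar)"
proof -
  obtain \<delta>\<^sub>0 where "\<delta>\<^sub>0 > 0" and "xbar \<in> X"
    and max: "\<forall>\<delta>\<in>{0<..\<delta>\<^sub>0}. \<forall>x\<in>X \<inter> cball xbar \<delta>. \<forall>y\<in>Y xbar \<inter> cball ybar \<delta>.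
      f (xbar, y) \<le> f (xbar, ybar)"
    using assms unfolding calm_local_minimax_def by metis
  then have "\<forall>y\<in>Y xbar \<inter> cball ybar \<delta>\<^sub>0. f (xbar, y) \<le> f (xbar, ybar)"
    using max[rule_format, of \<delta>\<^sub>0 xbar] by simp
  then show ?thesis
    unfolding eventually_nhds_metric using \<open>\<delta>\<^sub>0 > 0\<close>
    by (intro exI[of _ \<delta>\<^sub>0]) (auto simp: dist_commute)
qed

section \<open>Sufficient conditions\<close>

lemma normalized_differences_cluster_in_tangent_cone:
  fixes x :: "nat \<Rightarrow> 'a::euclidean_space"
  assumes x: "x \<longlonglongrightarrow> z" and S: "\<And>k. x k \<in> S" and ne: "\<And>k. x k \<noteq> z"
  obtains r u where "strict_mono r" and "u \<in> tangent_cone S z" and "u \<noteq> 0"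
    and "(\<lambda>k. (x (r k) - z) /\<^sub>R norm (x (r k) - z)) \<longlonglongrightarrow> u"
    and "(\<lambda>k. norm (x (r k) - z)) \<longlonglongrightarrow> 0"
proof -
  define q where "q k = (x k - z) /\<^sub>R norm (x k - z)" for k
  have unit: "norm (q k) = 1" for k
    using ne[of k] by (simp add: q_def)
  then have "bounded (range q)" unfolding bounded_iff by auto
  then obtain u r where r: "strict_mono r" and u: "(q \<circ> r) \<longlonglongrightarrow> u"
    using bounded_imp_convergent_subsequence[of q] by blast
  have t: "(\<lambda>k. norm (x (r k) - z)) \<longlonglongrightarrow> 0"
    using LIMSEQ_subseq_LIMSEQ[OF x r]
    by (simp add: o_def LIM_zero_iff tendsto_norm_zero_iff)
  show thesis
  proof (rule that[OF r])
    show "u \<in> tangent_cone S z"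
      unfolding tangent_cone_def
    proof (intro CollectI exI conjI allI)
      show "(\<lambda>k. norm (x (r k) - z)) \<longlonglongrightarrow> 0" by (fact t)
      show "(q \<circ> r) \<longlonglongrightarrow> u" by (fact u)
    qed (use ne S in \<open>auto simp: q_def\<close>)
    have "(\<lambda>k. norm ((q \<circ> r) k)) \<longlonglongrightarrow> norm u" by (intro tendsto_intros u)
    then have "norm u = 1" by (simp add: unit LIMSEQ_const_iff)
    then show "u \<noteq> 0" by auto
    show "(\<lambda>k. (x (r k) - z) /\<^sub>R norm (x (r k) - z)) \<longlonglongrightarrow> u"
      using u by (simp add: q_def o_def)
  qed (fact t)
qed

text \<open>The graphical derivative is the outer limit of the difference quotients of \<open>Y\<close>. Agreement
  with the inner limit upgrades \<^emph>\<open>some\<close> sequence to \<^emph>\<open>every\<close> sequence.\<close>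

lemma semidifferentiable_map_selection:
  assumes semi: "semidifferentiable_map Y xbar ybar"
    and h: "h \<in> graphical_derivative Y xbar ybar u"
    and t: "\<And>k. t k > 0" "t \<longlonglongrightarrow> 0" and v: "v \<longlonglongrightarrow> u"
  obtains w where "w \<longlonglongrightarrow> h"
    and "\<forall>\<^sub>F k in sequentially. ybar + t k *\<^sub>R w k \<in> Y (xbar + t k *\<^sub>R v k)"
proof -
  define Q where "Q = (\<lambda>(t, u'). (\<lambda>y'. (y' - ybar) /\<^sub>R t) ` Y (xbar + t *\<^sub>R u'))"
  obtain s p where s: "\<And>k. s k > 0" "s \<longlonglongrightarrow> 0" and p: "p \<longlonglongrightarrow> (u, h)"
    and mem: "\<And>k::nat. (xbar, ybar) + s k *\<^sub>R p k \<in> gph Y"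
    using h unfolding graphical_derivative_def tangent_cone_def by blast
  have "h \<in> outer_limit (dir_filter u) Q"
    unfolding outer_limit_def
  proof (intro CollectI exI conjI)
    show "filterlim (\<lambda>k. (s k, fst (p k))) (dir_filter u) sequentially"
      using filterlim_dir_filter[OF s] tendsto_fst[OF p] by simp
    show "(\<lambda>k. snd (p k)) \<longlonglongrightarrow> h" using tendsto_snd[OF p] by simp
    have "snd (p k) \<in> Q (s k, fst (p k))" for k
      unfolding Q_def using mem[of k] s(1)[of k]
      by (auto simp: gph_def plus_prod_def intro!: image_eqI[of _ _ "ybar + s k *\<^sub>R snd (p k)"])
    then show "\<forall>\<^sub>F k in sequentially. snd (p k) \<in> Q (s k, fst (p k))" by simp
  qed
  also have "outer_limit (dir_filter u) Q = inner_limit (dir_filter u) Q"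
    using semi unfolding semidifferentiable_map_def Let_def Q_def by blast
  finally obtain w where w: "w \<longlonglongrightarrow> h" and ev: "\<forall>\<^sub>F k in sequentially. w k \<in> Q (t k, v k)"
    using filterlim_dir_filter[OF t v] unfolding inner_limit_def by blast
  from ev have "\<forall>\<^sub>F k in sequentially. ybar + t k *\<^sub>R w k \<in> Y (xbar + t k *\<^sub>R v k)"
  proof eventually_elim
    case (elim k)
    then show ?case using t(1)[of k] by (auto simp: Q_def)
  qed
  with w show thesis by (rule that)
qed

text \<open>The ball around \<open>ybar\<close> has a radius proportional to the distance from \<open>x\<close> to \<open>xbar\<close>, which is
  what turns \<open>\<tau> \<delta> = l * \<delta>\<close> into an admissible radius function.\<close>

lemma eventually_maximizer_in_calm_ball:
  fixes f :: "'a::euclidean_space \<times> 'b::euclidean_space \<Rightarrow> real"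
  assumes ybar: "ybar \<in> Y xbar" and semi: "semidifferentiable_map Y xbar ybar"
    and U: "open U" "xbar \<in> U" and V: "open V" "ybar \<in> V"
    and calm: "\<And>x. x \<in> U \<Longrightarrow> Y x \<inter> V \<subseteq> cball ybar (l * norm (x - xbar))" and "l > 0"
    and pos: "\<And>u. \<lbrakk>u \<in> tangent_cone X xbar; u \<noteq> 0\<rbrakk> \<Longrightarrow>
      (SUP h\<in>graphical_derivative Y xbar ybar u. subderivative f (xbar, ybar) (u, h)) > 0"
  shows "\<forall>\<^sub>F x in nhds xbar. x \<in> X \<longrightarrow>
    (\<exists>y\<in>Y x \<inter> cball ybar (l * norm (x - xbar)). f (x, y) \<ge> f (xbar, ybar))"
    (is "\<forall>\<^sub>F x in nhds xbar. x \<in> X \<longrightarrow> ?good x")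
proof (rule ccontr)
  assume "\<not> ?thesis"
  then have ex: "\<exists>x. dist x xbar < d \<and> x \<in> X \<and> \<not> ?good x" if "d > 0" for d
    using that unfolding eventually_nhds_metric by blast
  have "\<exists>x. dist x xbar < inverse (real (Suc k)) \<and> x \<in> X \<and> \<not> ?good x" for k
    by (rule ex) simp
  then obtain x where d: "\<And>k. dist (x k) xbar < inverse (real (Suc k))"
    and X: "\<And>k. x k \<in> X" and bad: "\<And>k. \<not> ?good (x k)"
    by metis
  have x: "x \<longlonglongrightarrow> xbar"
    by (rule tendsto_dist_iff[THEN iffD2],
        rule tendsto_sandwich[OF _ _ tendsto_const LIMSEQ_inverse_real_of_nat])
      (use d in \<open>auto intro!: always_eventually less_imp_le\<close>)
  \<comment> \<open>Over \<open>xbar\<close> the point \<open>ybar\<close> itself is a witness.\<close>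
  have ne: "x k \<noteq> xbar" for k
  proof
    assume "x k = xbar"
    then show False using bad[of k] ybar by auto
  qed
  obtain r u where r: "strict_mono r" and u: "u \<in> tangent_cone X xbar" "u \<noteq> 0"
    and v: "(\<lambda>k. (x (r k) - xbar) /\<^sub>R norm (x (r k) - xbar)) \<longlonglongrightarrow> u"
    and t0: "(\<lambda>k. norm (x (r k) - xbar)) \<longlonglongrightarrow> 0"
    by (rule normalized_differences_cluster_in_tangent_cone[OF x X ne])
  define t where "t = (\<lambda>k. norm (x (r k) - xbar))"
  define v where "v = (\<lambda>k. (x (r k) - xbar) /\<^sub>R t k)"
  have t: "\<And>k. t k > 0" "t \<longlonglongrightarrow> 0" and v: "v \<longlonglongrightarrow> u"
    using ne t0 v by (auto simp: t_def v_def)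
  have xv: "xbar + t k *\<^sub>R v k = x (r k)" for k
    using t(1)[of k] by (simp add: v_def)
  obtain h where h: "h \<in> graphical_derivative Y xbar ybar u"
    and df: "subderivative f (xbar, ybar) (u, h) > ereal 0"
    using pos[OF u] by (auto simp: less_SUP_iff zero_ereal_def)
  obtain w where w: "w \<longlonglongrightarrow> h"
    and Y: "\<forall>\<^sub>F k in sequentially. ybar + t k *\<^sub>R w k \<in> Y (xbar + t k *\<^sub>R v k)"
    by (rule semidifferentiable_map_selection[OF semi h t v])
  have "(\<lambda>k. ybar + t k *\<^sub>R w k) \<longlonglongrightarrow> ybar + 0 *\<^sub>R h"
    by (intro tendsto_intros t w)
  then have inV: "\<forall>\<^sub>F k in sequentially. ybar + t k *\<^sub>R w k \<in> V"
    using V by (intro topological_tendstoD) auto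
  have inU: "\<forall>\<^sub>F k in sequentially. x (r k) \<in> U"
    using LIMSEQ_subseq_LIMSEQ[OF x r] U by (auto simp: o_def dest: topological_tendstoD)
  have "filterlim (\<lambda>k. (t k, (v k, w k))) (dir_filter (u, h)) sequentially"
    by (intro filterlim_dir_filter t tendsto_Pair v w)
  then have "\<forall>\<^sub>F k in sequentially.
      f (xbar + t k *\<^sub>R v k, ybar + t k *\<^sub>R w k) > f (xbar, ybar)"
    using eventually_compose_filterlim[OF eventually_greater_if_subderivative_greater[OF df]]
    by (force simp: case_prod_unfold)
  with Y inV inU have "\<forall>\<^sub>F k in sequentially. False"
  proof eventually_elim
    case (elim k)
    let ?y = "ybar + t k *\<^sub>R w k"
    have "?y \<in> Y (x (r k)) \<inter> V" using elim(1,2) by (simp add: xv)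
    then have "?y \<in> Y (x (r k)) \<inter> cball ybar (l * norm (x (r k) - xbar))"
      using calm[OF elim(3)] by blast
    moreover have "f (x (r k), ?y) \<ge> f (xbar, ybar)" using elim(4) by (simp add: xv)
    ultimately show ?case using bad[of "r k"] by blast
  qed
  then show False by simp
qed

lemma calm_local_minimax_if_positive_subderivative:
  fixes f :: "'a::euclidean_space \<times> 'b::euclidean_space \<Rightarrow> real"
  assumes xbar: "xbar \<in> X" and ybar: "ybar \<in> Y xbar"
    and semi: "semidifferentiable_map Y xbar ybar" and calm: "calm_map_around Y xbar ybar"
    and pos: "\<And>u. \<lbrakk>u \<in> tangent_cone X xbar; u \<noteq> 0\<rbrakk> \<Longrightarrow>
      (SUP h\<in>graphical_derivative Y xbar ybar u. subderivative f (xbar, ybar) (u, h)) > 0"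
  shows "calm_local_minimax f X Y xbar ybar"
proof -
  obtain l U V where "l > 0" and U: "open U" "xbar \<in> U" and V: "open V" "ybar \<in> V"
    and sub: "\<And>x. x \<in> U \<Longrightarrow> Y x \<inter> V \<subseteq> cball ybar (l * norm (x - xbar))"
    using calm unfolding calm_map_around_def by blast
  obtain e where "e > 0" and e: "cball ybar e \<subseteq> V"
    using V open_contains_cball by blast
  obtain d where "d > 0" and d: "\<And>x. \<lbrakk>dist x xbar < d; x \<in> X\<rbrakk> \<Longrightarrow>
      \<exists>y\<in>Y x \<inter> cball ybar (l * norm (x - xbar)). f (x, y) \<ge> f (xbar, ybar)"
    using eventually_maximizer_in_calm_ball[OF ybar semi U V sub \<open>l > 0\<close> pos]
    unfolding eventually_nhds_metric by blast
  define \<delta>\<^sub>0 where "\<delta>\<^sub>0 = min e (d / 2)"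
  have main: "f (xbar, y) \<le> f (xbar, ybar) \<and>
      ereal (f (xbar, ybar)) \<le> (SUP y'\<in>Y x \<inter> cball ybar (l * \<delta>). ereal (f (x, y')))"
    if \<delta>: "\<delta> \<in> {0<..\<delta>\<^sub>0}" and x: "x \<in> X \<inter> cball xbar \<delta>" and y: "y \<in> Y xbar \<inter> cball ybar \<delta>"
    for \<delta> x y
  proof
    \<comment> \<open>At \<open>x = xbar\<close> the calmness ball degenerates to a point.\<close>
    have "y \<in> V" using y \<delta> e by (auto simp: \<delta>\<^sub>0_def)
    then have "y = ybar" using sub[OF U(2)] y by auto
    then show "f (xbar, y) \<le> f (xbar, ybar)" by simp
    have "dist x xbar < d" using x \<delta> \<open>d > 0\<close> by (auto simp: \<delta>\<^sub>0_def dist_commute)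
    then obtain y' where y': "y' \<in> Y x" "dist ybar y' \<le> l * norm (x - xbar)"
      and ge: "f (x, y') \<ge> f (xbar, ybar)"
      using d[of x] x by auto
    have "l * norm (x - xbar) \<le> l * \<delta>"
      using x \<open>l > 0\<close> by (intro mult_left_mono) (auto simp: dist_norm norm_minus_commute)
    with y' ge show "ereal (f (xbar, ybar)) \<le>
        (SUP y'\<in>Y x \<inter> cball ybar (l * \<delta>). ereal (f (x, y')))"
      by (intro SUP_upper2[of y']) auto
  qed
  have "((\<lambda>\<delta>. l * \<delta>) \<longlongrightarrow> l * 0) (at_right 0)" by (intro tendsto_intros)
  then have lim: "((\<lambda>\<delta>. l * \<delta>) \<longlongrightarrow> 0) (at_right 0)" by simp
  have growth: "\<exists>\<kappa>>0. \<forall>\<delta>\<ge>0. l * \<delta> \<le> \<kappa> * \<delta>"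
    using \<open>l > 0\<close> by blast
  have "\<delta>\<^sub>0 > 0" using \<open>e > 0\<close> \<open>d > 0\<close> by (simp add: \<delta>\<^sub>0_def)
  show ?thesis
    unfolding calm_local_minimax_def
    by (rule conjI[OF xbar], rule conjI[OF ybar], rule exI[of _ \<delta>\<^sub>0],
        rule conjI[OF \<open>\<delta>\<^sub>0 > 0\<close>], rule exI[of _ "\<lambda>\<delta>. l * \<delta>"])
      (use \<open>l > 0\<close> main in \<open>intro conjI growth lim; force\<close>)
qed

section \<open>The optimality conditions\<close>

theorem theorem4p1:
  fixes f :: "(real ^ 'n) \<times> (real ^ 'm) \<Rightarrow> real"
    and X :: "(real ^ 'n) set"
    and Y :: "real ^ 'n \<Rightarrow> (real ^ 'm) set"
    and xbar :: "real ^ 'n"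
    and ybar :: "real ^ 'm"
  assumes "X \<noteq> {}" and "closed X"
    and "\<And>x. x \<in> X \<Longrightarrow> Y x \<noteq> {} \<and> closed (Y x)"
    and "\<And>x. x \<in> X \<Longrightarrow> \<exists>y\<in>Y x. \<forall>y'\<in>Y x. f (x, y') \<le> f (x, y)"
    and "xbar \<in> X" and "ybar \<in> Y xbar"
  shows
    "((Y xbar = UNIV \<or> semidifferentiable_fun (\<lambda>y. f (xbar, y)) ybar) \<and>
      (\<forall>\<^sub>F x in nhds xbar. x \<in> X \<longrightarrow> continuous_on UNIV (\<lambda>y. f (x, y))) \<and>
      calm_local_minimax f X Y xbar ybar
      \<longrightarrow>
      (\<forall>u\<in>tangent_cone X xbar.
         (SUP h\<in>graphical_derivative Y xbar ybar u.
            superderivative f (xbar, ybar) (u, h)) \<ge> 0) \<and>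
      (\<forall>h\<in>tangent_cone (Y xbar) ybar.
         superderivative (\<lambda>y. f (xbar, y)) ybar h \<le> 0))
     \<and>
     (semidifferentiable_fun f (xbar, ybar) \<and>
      semidifferentiable_map Y xbar ybar \<and>
      calm_map_around Y xbar ybar \<and>
      (\<forall>u\<in>tangent_cone X xbar - {0}.
         (SUP h\<in>graphical_derivative Y xbar ybar u.
            subderivative f (xbar, ybar) (u, h)) > 0) \<and>
      (\<forall>h\<in>tangent_cone (Y xbar) ybar - {0}.
         subderivative (\<lambda>y. f (xbar, y)) ybar h < 0)
      \<longrightarrow>
      calm_local_minimax f X Y xbar ybar)"
proof (rule conjI; intro impI; elim conjE)
  assume alt: "Y xbar = UNIV \<or> semidifferentiable_fun (\<lambda>y. f (xbar, y)) ybar"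
    and minimax: "calm_local_minimax f X Y xbar ybar"
  show "(\<forall>u\<in>tangent_cone X xbar.
         (SUP h\<in>graphical_derivative Y xbar ybar u.
            superderivative f (xbar, ybar) (u, h)) \<ge> 0) \<and>
      (\<forall>h\<in>tangent_cone (Y xbar) ybar.
         superderivative (\<lambda>y. f (xbar, y)) ybar h \<le> 0)"
  proof (intro conjI ballI)
    fix u assume "u \<in> tangent_cone X xbar"
    then obtain h where "h \<in> graphical_derivative Y xbar ybar u"
      and "superderivative f (xbar, ybar) (u, h) \<ge> 0"
      by (rule calm_local_minimax_imp_superderivative_nonneg[OF minimax])
    then show "(SUP h\<in>graphical_derivative Y xbar ybar u.
        superderivative f (xbar, ybar) (u, h)) \<ge> 0"
      by (rule SUP_upper2)
  next
    fix h assume "h \<in> tangent_cone (Y xbar) ybar"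
    with calm_local_minimax_imp_local_max[OF minimax] alt
    show "superderivative (\<lambda>y. f (xbar, y)) ybar h \<le> 0"
      by (rule superderivative_nonpos_if_local_max)
  qed
next
  assume "semidifferentiable_map Y xbar ybar" and "calm_map_around Y xbar ybar"
    and "\<forall>u\<in>tangent_cone X xbar - {0}.
         (SUP h\<in>graphical_derivative Y xbar ybar u.
            subderivative f (xbar, ybar) (u, h)) > 0"
  then show "calm_local_minimax f X Y xbar ybar"
    using assms(5,6) by (intro calm_local_minimax_if_positive_subderivative) auto
qed

end
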